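(* Let $F$ be a field with a valuation $v$, valuation ring $O_v$ and value group $\Gamma_v$. Let $E/F$ be a finite field extension and let $R\subseteq E$ be a subring such that $R\cap F=O_v$ and $E$ is the field of fractions of $R$. Let $w:R\to\mathcal M(\Gamma_v)\cup\{\infty\}$ be the filter quasi-valuation on $R$ induced by $(R,v)$, and for $r\in R$, $0\ne s\in O_v$ put $W(rs^{-1})=w(r)-v(s)$. (Every element of $E$ has the form $rs^{-1}$ with $r\in R$, $0\neq s\in O_v$.) Then $W$ is a well-defined quasi-valuation $W:E\to\mathcal M(\Gamma_v)\cup\{\infty\}$ which extends $v$ (i.e. $W|_F=v$) and satisfies $O_W=R$, where $O_W=\{x\in E\mid W(x)\ge 0\}$.
   Context: A totally ordered abelian monoid is a commutative monoid $(M,+)$ with a total order such that $a\le b$ implies $a+c\le b+c$. One adjoins $\infty$, greater than all elements of $M$, with $m+\infty=\infty$. A quasi-valuation on a ring $A$ is a function $w:A\to M\cup\{\infty\}$, $M$ a totally ordered abelian monoid, with $w(0)=\infty$, $w(xy)\ge w(x)+w(y)$ and $w(x+y)\ge\min\{w(x),w(y)\}$ for all $x,y\in A$. Cut monoid. For a totally ordered abelian group $\Gamma$, a cut $\mathcal A=(\mathcal A^L,\mathcal A^R)$ is a partition of $\Gamma$ into two (possibly empty) subsets with $\alpha<\beta$ for all $\alpha\in\mathcal A^L,\beta\in\mathcal A^R$. $\mathcal M(\Gamma)$ is the set of all cuts, ordered by $\mathcal A\le\mathcal B$ iff $\mathcal A^L\subseteq\mathcal B^L$, with addition $(\mathcal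 A+\mathcal B)^L=\mathcal A^L+\mathcal B^L=\{\alpha+\beta\mid\alpha\in\mathcal A^L,\beta\in\mathcal B^L\}$; it is a totally ordered abelian monoid. For $S\subseteq\Gamma$, $S^+$ is the smallest cut $\mathcal A$ with $S\subseteq\mathcal A^L$. $\Gamma$ embeds in $\mathcal M(\Gamma)$ via $\alpha\mapsto\{\alpha\}^+=((-\infty,\alpha],(\alpha,\infty))$, and $\alpha$ is identified with its image; $\mathcal B-\alpha$ means $\mathcal B+(-\alpha)$, and $\infty-\alpha=\infty$. The adjoined $\infty$ is different from (and greater than) the cut $(\Gamma,\emptyset)$. Filter quasi-valuation. For an $O_v$-algebra $R$ and $x\in R$ let $S_x=\{a\in O_v\mid xR\subseteq aR\}$. The filter quasi-valuation on $R$ induced by $(R,v)$ is $w:R\to\mathcal M(\Gamma_v)\cup\{\infty\}$, $w(0)=\infty$ and $w(x)=v(S_x)^+$ for $x\ne0$, where $v(S_x)=\{v(a)\mid a\in S_x\}$. *)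

theory Defs
  imports
    "HOL-Algebra.Finite_Extensions"
    "HOL-Library.Lattice_Constructions"
begin

section \<open>Adjoining infinity to a totally ordered abelian monoid\<close>

text \<open>
  The library type \<open>'m top\<close> adds a greatest element \<open>Top\<close> to a linear order; \<open>Top\<close> plays the
  role of infinity here. The same-named constructors of the other types of that theory are hidden.
\<close>

hide_const (open) bot.Value flat_complete_lattice.Value flat_complete_lattice.Top

instantiation top :: (ordered_comm_monoid_add) comm_monoid_add
begin

definition zero_top :: "'a top" where
  "0 = Value 0"

definition plus_top :: "'a top \<Rightarrow> 'a top \<Rightarrow> 'a top" where
  "x + y = (case x of Top \<Rightarrow> Top | Value a \<Rightarrow> (case y of Top \<Rightarrow> Top | Value b \<Rightarrow> Value (a + b)))"

instance
  by standard (auto simp: zero_top_def plus_top_def add_ac split: top.splits)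

end

instance top :: (ordered_comm_monoid_add) ordered_comm_monoid_add
  by standard (auto simp: plus_top_def less_eq_top_def add_left_mono split: top.splits)

lemma plus_top_simps [simp]:
  "Value a + Value b = Value (a + b)" "Top + x = Top" "x + Top = (Top :: 'a::ordered_comm_monoid_add top)"
  by (auto simp: plus_top_def split: top.splits)


section \<open>The cut monoid\<close>

typedef (overloaded) ('g::linorder) cut =
  "{(L :: 'g set, R :: 'g set). L \<union> R = UNIV \<and> L \<inter> R = {} \<and> (\<forall>\<alpha>\<in>L. \<forall>\<beta>\<in>R. \<alpha> < \<beta>)}"
  by (rule exI[of _ "(UNIV, {})"]) simp

definition cut_left :: "'g::linorder cut \<Rightarrow> 'g set" where
  "cut_left A = fst (Rep_cut A)"

definition cut_right :: "'g::linorder cut \<Rightarrow> 'g set" where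
  "cut_right A = snd (Rep_cut A)"

definition cut_of_left :: "'g::linorder set \<Rightarrow> 'g cut" where
  "cut_of_left L = Abs_cut (L, - L)"

lemma cut_right_eq: "cut_right A = - cut_left A"
  using Rep_cut[of A] by (auto simp: cut_left_def cut_right_def)

lemma cut_left_downward: "\<beta> \<in> cut_left A \<Longrightarrow> \<alpha> \<le> \<beta> \<Longrightarrow> \<alpha> \<in> cut_left A"
  using Rep_cut[of A] by (fastforce simp: cut_left_def)

lemma cut_eqI: "cut_left A = cut_left B \<Longrightarrow> A = B"
  using cut_right_eq[of A] cut_right_eq[of B]
  by (metis Rep_cut_inject cut_left_def cut_right_def prod.collapse)

lemma cut_left_of_left:
  assumes "\<And>\<alpha> \<beta>. \<beta> \<in> L \<Longrightarrow> \<alpha> \<le> \<beta> \<Longrightarrow> \<alpha> \<in> L"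
  shows "cut_left (cut_of_left L) = L"
proof -
  have "(L, - L) \<in> {(L :: 'a set, R). L \<union> R = UNIV \<and> L \<inter> R = {} \<and> (\<forall>\<alpha>\<in>L. \<forall>\<beta>\<in>R. \<alpha> < \<beta>)}"
    using assms by (auto simp: not_le[symmetric])
  then show ?thesis
    by (simp add: cut_left_def cut_of_left_def Abs_cut_inverse)
qed

instantiation cut :: (linorder) linorder
begin

definition less_eq_cut :: "'a cut \<Rightarrow> 'a cut \<Rightarrow> bool" where
  "A \<le> B \<longleftrightarrow> cut_left A \<subseteq> cut_left B"

definition less_cut :: "'a cut \<Rightarrow> 'a cut \<Rightarrow> bool" where
  "A < B \<longleftrightarrow> cut_left A \<subset> cut_left B"

instance
proof
  fix A B :: "'a cut"
  show "A \<le> B \<or> B \<le> A"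
    unfolding less_eq_cut_def by (meson cut_left_downward linear subsetI)
qed (auto simp: less_eq_cut_def less_cut_def intro: cut_eqI)

end

text \<open>The smallest cut whose left part contains \<open>S\<close>, usually written \<open>S\<^sup>+\<close>.\<close>

definition cut_hull :: "'g::linorder set \<Rightarrow> 'g cut" where
  "cut_hull S = (LEAST A. S \<subseteq> cut_left A)"

lemma cut_left_cut_hull: "cut_left (cut_hull S) = {\<alpha>. \<exists>\<beta>\<in>S. \<alpha> \<le> \<beta>}"
proof -
  let ?L = "{\<alpha>. \<exists>\<beta>\<in>S. \<alpha> \<le> \<beta>}"
  have L: "cut_left (cut_of_left ?L) = ?L"
    by (rule cut_left_of_left) (auto intro: order_trans)
  have "cut_hull S = cut_of_left ?L"
    unfolding cut_hull_def
  proof (rule Least_equality)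
    show "S \<subseteq> cut_left (cut_of_left ?L)"
      unfolding L by blast
    show "cut_of_left ?L \<le> A" if "S \<subseteq> cut_left A" for A
      using that cut_left_downward[of _ A] unfolding less_eq_cut_def L by blast
  qed
  then show ?thesis using L by simp
qed

instantiation cut :: (linordered_ab_group_add) comm_monoid_add
begin

definition zero_cut :: "'a cut" where
  "0 = cut_hull {0}"

definition plus_cut :: "'a cut \<Rightarrow> 'a cut \<Rightarrow> 'a cut" where
  "A + B = cut_of_left {\<alpha> + \<beta> | \<alpha> \<beta>. \<alpha> \<in> cut_left A \<and> \<beta> \<in> cut_left B}"

lemma cut_left_plus:
  "cut_left (A + B) = {\<alpha> + \<beta> | \<alpha> \<beta>. \<alpha> \<in> cut_left A \<and> \<beta> \<in> cut_left (B :: 'a cut)}"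
  unfolding plus_cut_def
proof (rule cut_left_of_left)
  fix \<gamma> \<delta>
  assume "\<delta> \<in> {\<alpha> + \<beta> | \<alpha> \<beta>. \<alpha> \<in> cut_left A \<and> \<beta> \<in> cut_left B}" and le: "\<gamma> \<le> \<delta>"
  then obtain \<alpha> \<beta> where ab: "\<delta> = \<alpha> + \<beta>" "\<alpha> \<in> cut_left A" "\<beta> \<in> cut_left B"
    by blast
  have "\<gamma> - \<beta> \<in> cut_left A"
    using ab(2) by (rule cut_left_downward) (use le ab(1) in \<open>simp add: diff_le_eq\<close>)
  then show "\<gamma> \<in> {\<alpha> + \<beta> | \<alpha> \<beta>. \<alpha> \<in> cut_left A \<and> \<beta> \<in> cut_left B}"
    using ab(3) by (intro CollectI exI[of _ "\<gamma> - \<beta>"] exI[of _ \<beta>]) simp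
qed

instance
proof
  fix A B C :: "'a cut"
  show "A + B + C = A + (B + C)"
  proof (rule cut_eqI, unfold cut_left_plus, safe)
    fix \<alpha> \<beta> \<gamma>
    assume "\<alpha> \<in> cut_left A" "\<beta> \<in> cut_left B" "\<gamma> \<in> cut_left C"
    then show "\<exists>\<alpha>' \<beta>'. \<alpha> + \<beta> + \<gamma> = \<alpha>' + \<beta>' \<and> \<alpha>' \<in> cut_left A \<and>
        \<beta>' \<in> {\<alpha> + \<beta> | \<alpha> \<beta>. \<alpha> \<in> cut_left B \<and> \<beta> \<in> cut_left C}"
      by (intro exI[of _ \<alpha>] exI[of _ "\<beta> + \<gamma>"]) (auto simp: add.assoc)
    from \<open>\<alpha> \<in> _\<close> \<open>\<beta> \<in> _\<close> \<open>\<gamma> \<in> _\<close>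
    show "\<exists>\<alpha>' \<beta>'. \<alpha> + (\<beta> + \<gamma>) = \<alpha>' + \<beta>' \<and>
        \<alpha>' \<in> {\<alpha> + \<beta> | \<alpha> \<beta>. \<alpha> \<in> cut_left A \<and> \<beta> \<in> cut_left B} \<and> \<beta>' \<in> cut_left C"
      by (intro exI[of _ "\<alpha> + \<beta>"] exI[of _ \<gamma>]) (auto simp: add.assoc)
  qed
  show "A + B = B + A"
    by (rule cut_eqI, unfold cut_left_plus) (metis (no_types, opaque_lifting) add.commute)
  show "0 + A = A"
  proof (rule cut_eqI, unfold cut_left_plus zero_cut_def cut_left_cut_hull, safe)
    fix \<alpha> \<beta> :: 'a
    assume "\<alpha> \<le> 0" "\<beta> \<in> cut_left A"
    then show "\<alpha> + \<beta> \<in> cut_left A"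
      using cut_left_downward[of \<beta> A "\<alpha> + \<beta>"] by simp
  next
    fix \<alpha> :: 'a
    assume "\<alpha> \<in> cut_left A"
    then show "\<exists>\<alpha>' \<beta>. \<alpha> = \<alpha>' + \<beta> \<and> \<alpha>' \<in> {\<alpha>. \<exists>\<beta>\<in>{0}. \<alpha> \<le> \<beta>} \<and> \<beta> \<in> cut_left A"
      by (intro exI[of _ 0] exI[of _ \<alpha>]) simp
  qed
qed

end

instance cut :: (linordered_ab_group_add) ordered_comm_monoid_add
proof
  fix A B C :: "'a cut"
  assume "A \<le> B"
  then show "C + A \<le> C + B"
    unfolding less_eq_cut_def cut_left_plus by blast
qed

text \<open>
  The embedding of the value group with infinity into the cut monoid with infinity, and
  the operation \<open>B - \<alpha> = B + (- \<alpha>)\<close> for a cut \<open>B\<close> (or infinity) and a group element \<open>\<alpha>\<close>.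
\<close>

definition embed_val :: "'g::linordered_ab_group_add top \<Rightarrow> 'g cut top" where
  "embed_val x = map_top (\<lambda>\<alpha>. cut_hull {\<alpha>}) x"

definition minus_val ::
  "'g::linordered_ab_group_add cut top \<Rightarrow> 'g \<Rightarrow> 'g cut top" (infixl \<open>\<ominus>\<^sub>v\<close> 65) where
  "B \<ominus>\<^sub>v \<alpha> = B + embed_val (Value (- \<alpha>))"


section \<open>Valuations and quasi-valuations\<close>

definition valuation ::
  "('a, 'b) ring_scheme \<Rightarrow> ('a \<Rightarrow> 'g::linordered_ab_group_add top) \<Rightarrow> bool" where
  "valuation K v \<longleftrightarrow>
     (\<forall>x\<in>carrier K. v x = Top \<longleftrightarrow> x = \<zero>\<^bsub>K\<^esub>) \<and>
     (\<forall>x\<in>carrier K. \<forall>y\<in>carrier K. v (x \<otimes>\<^bsub>K\<^esub> y) = v x + v y) \<and>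
     (\<forall>x\<in>carrier K. \<forall>y\<in>carrier K. v (x \<oplus>\<^bsub>K\<^esub> y) \<ge> min (v x) (v y))"

definition quasi_valuation ::
  "('a, 'b) ring_scheme \<Rightarrow> ('a \<Rightarrow> 'm::{linorder, ordered_comm_monoid_add} top) \<Rightarrow> bool" where
  "quasi_valuation A w \<longleftrightarrow>
     w \<zero>\<^bsub>A\<^esub> = Top \<and>
     (\<forall>x\<in>carrier A. \<forall>y\<in>carrier A. w (x \<otimes>\<^bsub>A\<^esub> y) \<ge> w x + w y) \<and>
     (\<forall>x\<in>carrier A. \<forall>y\<in>carrier A. w (x \<oplus>\<^bsub>A\<^esub> y) \<ge> min (w x) (w y))"

text \<open>For a valuation this is the valuation ring; for a quasi-valuation it is the ring \<open>O_w\<close>.\<close>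

definition val_ring :: "'a set \<Rightarrow> ('a \<Rightarrow> 'm::ordered_comm_monoid_add top) \<Rightarrow> 'a set" where
  "val_ring K w = {x \<in> K. w x \<ge> 0}"

definition fraction_field_of :: "('a, 'b) ring_scheme \<Rightarrow> 'a set \<Rightarrow> bool" where
  "fraction_field_of E R \<longleftrightarrow>
     (\<forall>x\<in>carrier E. \<exists>a\<in>R. \<exists>b\<in>R - {\<zero>\<^bsub>E\<^esub>}. x = a \<otimes>\<^bsub>E\<^esub> inv\<^bsub>E\<^esub> b)"


section \<open>The filter quasi-valuation\<close>

text \<open>
  The algebra \<open>R\<close> is a subset of an ambient ring \<open>E\<close> that also contains the valuation ring of
  \<open>v\<close> on \<open>F\<close>, so that scalar multiplication is multiplication in \<open>E\<close>.
\<close>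

definition filter_support ::
  "('a, 'b) ring_scheme \<Rightarrow> 'a set \<Rightarrow> ('a \<Rightarrow> 'g::linordered_ab_group_add top) \<Rightarrow> 'a set \<Rightarrow> 'a \<Rightarrow> 'a set"
  where
  "filter_support E F v R x = {a \<in> val_ring F v. x <#\<^bsub>E\<^esub> R \<subseteq> a <#\<^bsub>E\<^esub> R}"

definition filter_qv ::
  "('a, 'b) ring_scheme \<Rightarrow> 'a set \<Rightarrow> ('a \<Rightarrow> 'g::linordered_ab_group_add top) \<Rightarrow> 'a set \<Rightarrow> 'a \<Rightarrow> 'g cut top"
  where
  "filter_qv E F v R x =
     (if x = \<zero>\<^bsub>E\<^esub> then Top else Value (cut_hull {\<alpha>. Value \<alpha> \<in> v ` filter_support E F v R x}))"

text \<open>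
  The condition \<open>W (r s\<inverse>) = w r - v s\<close>, imposed on every representation of an element as such
  a fraction; \<open>\<alpha>\<close> names the value of \<open>s\<close>, which is finite because \<open>s\<close> is nonzero.
\<close>

definition fraction_rule ::
  "('a, 'b) ring_scheme \<Rightarrow> 'a set \<Rightarrow> ('a \<Rightarrow> 'g::linordered_ab_group_add top) \<Rightarrow> 'a set
     \<Rightarrow> ('a \<Rightarrow> 'g cut top) \<Rightarrow> bool"
  where
  "fraction_rule E F v R W \<longleftrightarrow>
     (\<forall>r\<in>R. \<forall>s\<in>val_ring F v - {\<zero>\<^bsub>E\<^esub>}. \<forall>\<alpha>. v s = Value \<alpha> \<longrightarrow>
        W (r \<otimes>\<^bsub>E\<^esub> inv\<^bsub>E\<^esub> s) = filter_qv E F v R r \<ominus>\<^sub>v \<alpha>)"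

end

(*
  For nonzero x in E consider the down-set L x of all values v a with a in F and x in aR. For x in R
  it is the left part of the cut w x: the scalars a that are not in O_v have negative value and add
  nothing, because 1 is in the filter S_x. Unlike S_x, the set L x makes sense on all of E, and
  L (x/s) = L x - v s, so x \<mapsto> L x is the required W. The quasi-valuation axioms say
  L x + L y \<subseteq> L (xy) and L x \<inter> L y \<subseteq> L (x + y). Moreover, 0 \<in> L x means x \<in> R, and for x in F
  the hypothesis on R \<inter> F gives L x = {\<alpha>. \<alpha> \<le> v x}.
  Every element of E is a fraction with denominator in O_v because the elements with this property
  form a ring containing F and R, and the inverse of b in R is a polynomial in b over F.
*)

theory Submission
  imports Defs
begin

section \<open>Translation of cuts by group elements\<close>

text \<open>A member of the sum is \<beta> + \<delta> with \<beta> in the left part of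
  \<open>B\<close> and \<delta> \<le> \<open>- \<alpha>\<close>; since that left part is downward
  closed, only the extreme choice \<delta> = \<open>- \<alpha>\<close> matters.\<close>

lemma cut_left_minus:
  fixes B :: "'g::linordered_ab_group_add cut"
  shows "cut_left (B + cut_hull {- \<alpha>}) = {\<gamma>. \<gamma> + \<alpha> \<in> cut_left B}"
proof (rule Set.set_eqI)
  fix \<gamma>
  have "\<gamma> \<in> cut_left (B + cut_hull {- \<alpha>}) \<longleftrightarrow> (\<exists>\<beta>\<in>cut_left B. \<exists>\<delta>. \<gamma> = \<beta> + \<delta> \<and> \<delta> \<le> - \<alpha>)"
    unfolding cut_left_plus cut_left_cut_hull by blast
  also have "\<dots> \<longleftrightarrow> (\<exists>\<beta>\<in>cut_left B. \<gamma> + \<alpha> \<le> \<beta>)"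
  proof (rule bex_cong[OF refl])
    fix \<beta>
    have "(\<exists>\<delta>. \<gamma> = \<beta> + \<delta> \<and> \<delta> \<le> - \<alpha>) \<longleftrightarrow> \<gamma> - \<beta> \<le> - \<alpha>"
      by (metis add_diff_cancel_left' add.commute diff_add_cancel)
    also have "\<dots> \<longleftrightarrow> \<gamma> + \<alpha> \<le> \<beta>"
      using diff_le_eq[of \<gamma> \<beta> "- \<alpha>"] le_diff_eq[of \<gamma> \<beta> \<alpha>] by simp
    finally show "(\<exists>\<delta>. \<gamma> = \<beta> + \<delta> \<and> \<delta> \<le> - \<alpha>) \<longleftrightarrow> \<gamma> + \<alpha> \<le> \<beta>" .
  qed
  also have "\<dots> \<longleftrightarrow> \<gamma> + \<alpha> \<in> cut_left B"
    using cut_left_downward by blast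
  finally show "\<gamma> \<in> cut_left (B + cut_hull {- \<alpha>}) \<longleftrightarrow> \<gamma> \<in> {\<gamma>. \<gamma> + \<alpha> \<in> cut_left B}"
    by simp
qed

section \<open>The setting, and elementary facts on \<open>v\<close> and its valuation ring\<close>

text \<open>By \<open>value_group\<close> every element of \<open>'g\<close> is a value of
  \<open>v\<close>, so \<open>'g\<close> is the value group itself and its cuts form the cut monoid
  of the value group.\<close>

locale valued_extension = field E for E :: "('a, 'b) ring_scheme" (structure) +
  fixes F R :: "'a set" and v :: "'a \<Rightarrow> 'g::linordered_ab_group_add top"
  assumes subfield_F: "subfield F E"
    and finite_ext: "finite_dimension F (carrier E)"
    and valuation_v: "valuation (E\<lparr>carrier := F\<rparr>) v"
    and value_group: "v ` F = UNIV"
    and subring_R: "subring R E"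
    and R_Int_F: "R \<inter> F = val_ring F v"
    and frac: "fraction_field_of E R"
begin

lemmas F_sub [simp, intro] = subringE(2,3,6,7)[OF subfieldE(1)[OF subfield_F]]

lemmas R_sub [simp, intro] = subringE(2,3,6,7)[OF subring_R]

lemma F_carrier [simp]: "a \<in> F \<Longrightarrow> a \<in> carrier E"
  using subfieldE(3)[OF subfield_F] by blast

lemma R_carrier [simp]: "a \<in> R \<Longrightarrow> a \<in> carrier E"
  using subringE(1)[OF subring_R] by blast

lemma O_F: "a \<in> val_ring F v \<Longrightarrow> a \<in> F" and O_R: "a \<in> val_ring F v \<Longrightarrow> a \<in> R"
  using R_Int_F by auto

lemma inv_nonzero:
  assumes "x \<in> carrier E" "x \<noteq> \<zero>"
  shows "inv x \<in> carrier E" "inv x \<noteq> \<zero>" "x \<otimes> inv x = \<one>" "inv x \<otimes> x = \<one>"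
  using assms subfield_m_inv[OF carrier_is_subfield, of x] by auto

lemma eq_divide_iff:
  assumes "x \<in> carrier E" "y \<in> carrier E" "s \<in> carrier E" "s \<noteq> \<zero>"
  shows "x \<otimes> inv s = y \<longleftrightarrow> x = s \<otimes> y"
proof
  assume "x \<otimes> inv s = y"
  then have "s \<otimes> y = s \<otimes> (x \<otimes> inv s)"
    by simp
  also have "\<dots> = x \<otimes> (s \<otimes> inv s)"
    using assms inv_nonzero[of s] by (intro m_lcomm) auto
  finally show "x = s \<otimes> y"
    using assms inv_nonzero[of s] by simp
next
  assume "x = s \<otimes> y"
  then have "x \<otimes> inv s = y \<otimes> (s \<otimes> inv s)"
    using assms inv_nonzero[of s] by (simp add: m_comm[of s y] m_assoc)
  then show "x \<otimes> inv s = y"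
    using assms inv_nonzero[of s] by simp
qed

lemma v_eq_Top: "a \<in> F \<Longrightarrow> v a = Top \<longleftrightarrow> a = \<zero>"
  and v_mult: "a \<in> F \<Longrightarrow> b \<in> F \<Longrightarrow> v (a \<otimes> b) = v a + v b"
  using valuation_v by (auto simp: valuation_def)

lemma v_zero [simp]: "v \<zero> = Top"
  by (simp add: v_eq_Top)

lemma v_finite: "v a = Value \<alpha> \<Longrightarrow> a \<noteq> \<zero>"
  by auto

lemma v_nonzero:
  assumes "a \<in> F" "a \<noteq> \<zero>"
  obtains \<alpha> where "v a = Value \<alpha>"
  using assms v_eq_Top by (cases "v a") auto

lemma v_surj: obtains a where "a \<in> F" "a \<noteq> \<zero>" "v a = Value \<alpha>"
proof -
  obtain a where "a \<in> F" "v a = Value \<alpha>"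
    using value_group by (metis UNIV_I imageE)
  then show ?thesis
    using that[of a] v_finite by blast
qed

lemma v_one [simp]: "v \<one> = Value 0"
proof -
  obtain \<alpha> where "v \<one> = Value \<alpha>"
    using v_nonzero[of \<one>] by auto
  then show ?thesis
    using v_mult[of \<one> \<one>] by simp
qed

lemma O_iff: "a \<in> val_ring F v \<longleftrightarrow> a \<in> F \<and> Value 0 \<le> v a"
  by (simp add: val_ring_def zero_top_def)

lemma O_one: "\<one> \<in> val_ring F v - {\<zero>}"
  by (simp add: O_iff)

lemma F_divide:
  assumes a: "a \<in> F" and b: "b \<in> F" "b \<noteq> \<zero>"
  obtains c where "c \<in> F" "a = b \<otimes> c"
proof
  show "inv b \<otimes> a \<in> F"
    using subfield_m_inv(1)[OF subfield_F, of b] a b by auto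
  show "a = b \<otimes> (inv b \<otimes> a)"
    using a b inv_nonzero[of b] by (simp add: m_assoc[symmetric])
qed

lemma O_divide:
  assumes a: "a \<in> F" and b: "b \<in> F" "b \<noteq> \<zero>" and le: "v b \<le> v a"
  obtains c where "c \<in> val_ring F v" "a = b \<otimes> c"
proof -
  obtain c where c: "c \<in> F" "a = b \<otimes> c"
    using F_divide[OF a b] .
  obtain \<beta> where "v b = Value \<beta>"
    using v_nonzero[OF b] .
  \<comment> \<open>Here \<open>c\<close> may be zero; its value \<open>Top\<close> is then
    nonnegative as well.\<close>
  then have "Value 0 \<le> v c"
    using le c v_mult[OF b(1) c(1)] by (cases "v c") auto
  then show ?thesis
    using c that by (auto simp: O_iff)
qed

section \<open>Clearing denominators\<close>

lemma O_mult_nonzero: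
  assumes "s \<in> val_ring F v - {\<zero>}" "t \<in> val_ring F v - {\<zero>}"
  shows "s \<otimes> t \<in> val_ring F v - {\<zero>}"
proof -
  have "s \<otimes> t \<in> val_ring F v"
    using assms R_Int_F[symmetric] by auto
  then show ?thesis
    using assms integral[of s t] by (auto dest: O_F F_carrier)
qed

text \<open>Outside the valuation ring \<open>a\<close> has negative value, so its inverse lies in
  the valuation ring and can serve as \<open>s\<close>.\<close>

lemma clear_denominator_F:
  assumes "a \<in> F"
  obtains s where "s \<in> val_ring F v - {\<zero>}" "s \<otimes> a \<in> R"
proof (cases "a \<in> val_ring F v")
  case True
  then show ?thesis
    using that[OF O_one] by (auto dest: O_R)
next
  case False
  then have a: "a \<noteq> \<zero>" "v a \<le> v \<one>"
    using assms by (auto simp: O_iff)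
  obtain s where "s \<in> val_ring F v" "\<one> = a \<otimes> s"
    using O_divide[OF F_sub(2) assms a] by blast
  moreover have "s \<noteq> \<zero>"
    using \<open>\<one> = a \<otimes> s\<close> assms by auto
  ultimately show ?thesis
    using that[of s] m_comm[of s a] assms by (simp add: O_F \<open>\<one> = a \<otimes> s\<close>[symmetric])
qed

text \<open>F[b] is built by Horner steps from \<open>x\<close> to
  \<open>x \<otimes> b \<oplus> a\<close>. As \<open>b\<close> is in \<open>R\<close>, the product
  of a denominator of \<open>x\<close> and one of \<open>a\<close> clears the new element.\<close>

lemma clear_denominator_simple_extension:
  assumes "b \<in> R" "x \<in> simple_extension F b"
  shows "\<exists>s\<in>val_ring F v - {\<zero>}. s \<otimes> x \<in> R"
  using assms(2)
proof induction
  case zero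
  show ?case
    using O_one by (auto intro!: bexI[of _ \<one>])
next
  case (lin x a)
  then obtain s where s: "s \<in> val_ring F v - {\<zero>}" "s \<otimes> x \<in> R"
    by blast
  obtain t where t: "t \<in> val_ring F v - {\<zero>}" "t \<otimes> a \<in> R"
    using clear_denominator_F[OF \<open>a \<in> F\<close>] .
  have [simp]: "x \<in> carrier E"
    using lin(1) simple_extension_in_carrier[OF subfieldE(3)[OF subfield_F], of b] assms(1) by auto
  have [simp]: "s \<in> carrier E" "t \<in> carrier E"
    using s t by (auto dest: O_F)
  have "(s \<otimes> t) \<otimes> (x \<otimes> b \<oplus> a) = t \<otimes> ((s \<otimes> x) \<otimes> b) \<oplus> s \<otimes> (t \<otimes> a)"
    using assms(1) lin(2) by (simp add: r_distr m_ac)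
  also have "\<dots> \<in> R"
    using s t assms(1) by (auto dest: O_R)
  finally show ?case
    using O_mult_nonzero[OF s(1) t(1)] by blast
qed

lemma fraction_representation:
  assumes x: "x \<in> carrier E"
  shows "\<exists>r\<in>R. \<exists>s\<in>val_ring F v - {\<zero>}. x = r \<otimes> inv s"
proof -
  obtain a b where ab: "a \<in> R" "b \<in> R" "b \<noteq> \<zero>" "x = a \<otimes> inv b"
    using frac x unfolding fraction_field_of_def by blast
  \<comment> \<open>Finiteness of E/F enters here: \<open>b\<close> is algebraic, so F[b] is a field
    and contains \<open>inv b\<close>.\<close>
  have "(algebraic over F) b"
    using finite_dimension_imp_algebraic[OF subfield_F carrier_is_subring finite_ext] ab by simp
  then have K: "subfield (simple_extension F b) E"
    using simple_extension_is_subfield[OF subfield_F] ab by simp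
  have "inv b \<in> simple_extension F b"
    using subfield_m_inv(1)[OF K, of b] ab
      simple_extension_mem[OF subfieldE(1)[OF subfield_F], of b] by simp
  then obtain s where s: "s \<in> val_ring F v - {\<zero>}" "s \<otimes> inv b \<in> R"
    using clear_denominator_simple_extension ab by blast
  have sE: "s \<in> carrier E" "s \<noteq> \<zero>" and b: "inv b \<in> carrier E"
    using s ab inv_nonzero[of b] by (auto dest: O_F)
  \<comment> \<open>Because \<open>a\<close> is in \<open>R\<close>, a denominator of
    \<open>inv b\<close> also clears \<open>x\<close>.\<close>
  then have "s \<otimes> x = a \<otimes> (s \<otimes> inv b)"
    using ab by (simp add: m_ac)
  then have "s \<otimes> x \<in> R" "x = (s \<otimes> x) \<otimes> inv s"
    using s ab sE x eq_divide_iff[of "s \<otimes> x" x s] by auto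
  then show ?thesis
    using s by blast
qed

section \<open>The down-sets L x\<close>

text \<open>This is L x. Asking for a finite value excludes a = 0.\<close>

definition val_left :: "'a \<Rightarrow> 'g set" where
  "val_left x = {\<alpha>. \<exists>a\<in>F. v a = Value \<alpha> \<and> x \<in> a <# R}"

lemma mem_coset: "x \<in> a <# R \<longleftrightarrow> (\<exists>\<rho>\<in>R. x = a \<otimes> \<rho>)"
  by (auto simp: l_coset_def)

text \<open>The quotient a/b lies in the valuation ring, hence in \<open>R\<close>, and is absorbed
  by \<open>R\<close>.\<close>

lemma coset_mono:
  assumes "a \<in> F" "b \<in> F" "b \<noteq> \<zero>" "v b \<le> v a"
  shows "a <# R \<subseteq> b <# R"
proof
  fix x assume "x \<in> a <# R"
  then obtain \<rho> where \<rho>: "\<rho> \<in> R" "x = a \<otimes> \<rho>"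
    by (auto simp: mem_coset)
  obtain c where c: "c \<in> val_ring F v" "a = b \<otimes> c"
    using O_divide assms by metis
  then have "x = b \<otimes> (c \<otimes> \<rho>)"
    using \<rho> assms by (auto simp: m_assoc dest: O_F)
  then show "x \<in> b <# R"
    unfolding mem_coset using c \<rho> by (auto dest: O_R)
qed

lemma val_left_downward:
  assumes "\<beta> \<in> val_left x" "\<alpha> \<le> \<beta>"
  shows "\<alpha> \<in> val_left x"
proof -
  obtain b where b: "b \<in> F" "v b = Value \<beta>" "x \<in> b <# R"
    using assms by (auto simp: val_left_def)
  obtain a where a: "a \<in> F" "a \<noteq> \<zero>" "v a = Value \<alpha>"
    using v_surj .
  then show ?thesis
    using coset_mono[OF b(1) a(1,2)] a b assms(2) by (auto simp: val_left_def)
qed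

text \<open>Elements of equal finite value generate the same coset, by \<open>coset_mono\<close> in
  both directions. So one may test membership on any chosen scalar of value \<alpha>.\<close>

lemma mem_val_left_iff:
  assumes a: "a \<in> F" "v a = Value \<alpha>"
  shows "\<alpha> \<in> val_left x \<longleftrightarrow> x \<in> a <# R"
proof -
  have "x \<in> a <# R" if "b \<in> F" "v b = Value \<alpha>" "x \<in> b <# R" for b
    using coset_mono[of b a] that a v_finite[OF a(2)] by auto
  then show ?thesis
    using a by (auto simp: val_left_def)
qed

lemma val_left_mult:
  assumes "\<alpha> \<in> val_left x" "\<beta> \<in> val_left y"
  shows "\<alpha> + \<beta> \<in> val_left (x \<otimes> y)"
proof -
  obtain a \<rho> where a: "a \<in> F" "v a = Value \<alpha>" "\<rho> \<in> R" "x = a \<otimes> \<rho>"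
    using assms(1) by (auto simp: val_left_def mem_coset)
  obtain b \<sigma> where b: "b \<in> F" "v b = Value \<beta>" "\<sigma> \<in> R" "y = b \<otimes> \<sigma>"
    using assms(2) by (auto simp: val_left_def mem_coset)
  have "x \<otimes> y = (a \<otimes> b) \<otimes> (\<rho> \<otimes> \<sigma>)"
    using a b by (simp add: m_ac)
  then have "x \<otimes> y \<in> (a \<otimes> b) <# R"
    unfolding mem_coset using a b by blast
  then show ?thesis
    using mem_val_left_iff[of "a \<otimes> b"] a b v_mult by simp
qed

text \<open>One scalar \<open>a\<close> of value \<alpha> serves both summands, and aR is closed
  under addition.\<close>

lemma val_left_add:
  assumes "\<alpha> \<in> val_left x" "\<alpha> \<in> val_left y"
  shows "\<alpha> \<in> val_left (x \<oplus> y)"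
proof -
  obtain a where a: "a \<in> F" "v a = Value \<alpha>"
    using v_surj by metis
  then obtain \<rho> \<sigma> where "\<rho> \<in> R" "x = a \<otimes> \<rho>" "\<sigma> \<in> R" "y = a \<otimes> \<sigma>"
    using assms by (auto simp: mem_val_left_iff mem_coset)
  then have "x \<oplus> y = a \<otimes> (\<rho> \<oplus> \<sigma>)" "\<rho> \<oplus> \<sigma> \<in> R"
    using a by (simp_all add: r_distr)
  then show ?thesis
    using a by (auto simp: mem_val_left_iff mem_coset)
qed

text \<open>Multiplying by \<open>s\<close> turns x/s \<in> aR into x \<in> (as)R, and as has value
  \<alpha> + \<sigma>.\<close>

lemma val_left_divide:
  assumes x: "x \<in> carrier E" and s: "s \<in> F" "v s = Value \<sigma>"
  shows "val_left (x \<otimes> inv s) = {\<alpha>. \<alpha> + \<sigma> \<in> val_left x}"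
proof (rule Set.set_eqI)
  fix \<alpha>
  obtain a where a: "a \<in> F" "v a = Value \<alpha>"
    using v_surj by metis
  have "s \<noteq> \<zero>"
    using s v_finite by blast
  then have "x \<otimes> inv s \<in> a <# R \<longleftrightarrow> (\<exists>\<rho>\<in>R. x = s \<otimes> (a \<otimes> \<rho>))"
    unfolding mem_coset using x s a by (auto simp: eq_divide_iff)
  also have "\<dots> \<longleftrightarrow> x \<in> (a \<otimes> s) <# R"
    unfolding mem_coset using s a by (intro bex_cong refl) (simp add: m_ac)
  finally show "\<alpha> \<in> val_left (x \<otimes> inv s) \<longleftrightarrow> \<alpha> \<in> {\<alpha>. \<alpha> + \<sigma> \<in> val_left x}"
    using mem_val_left_iff[OF a] mem_val_left_iff[of "a \<otimes> s" "\<alpha> + \<sigma>"] a s v_mult by simp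
qed

lemma zero_mem_val_left: "x \<in> carrier E \<Longrightarrow> 0 \<in> val_left x \<longleftrightarrow> x \<in> R"
  using mem_val_left_iff[of \<one> 0] by (auto simp: mem_coset intro!: bexI[of _ x])

text \<open>Write x = ac with c in \<open>F\<close>. Then x \<in> aR means c \<in> R, which by the
  hypothesis on R \<inter> F means that \<open>c\<close> has nonnegative value.\<close>

lemma val_left_F:
  assumes x: "x \<in> F" "v x = Value \<xi>"
  shows "val_left x = {\<alpha>. \<alpha> \<le> \<xi>}"
proof (rule Set.set_eqI)
  fix \<alpha>
  obtain a where a: "a \<in> F" "a \<noteq> \<zero>" "v a = Value \<alpha>"
    using v_surj .
  obtain c where c: "c \<in> F" "x = a \<otimes> c"
    using F_divide[OF x(1) a(1,2)] .
  have "x \<in> a <# R \<longleftrightarrow> c \<in> R"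
    unfolding mem_coset using a c m_lcancel[of a c] by auto
  also have "\<dots> \<longleftrightarrow> Value 0 \<le> v c"
    using c R_Int_F O_iff by blast
  also have "\<dots> \<longleftrightarrow> \<alpha> \<le> \<xi>"
    using x c a v_mult[OF a(1) c(1)] by (cases "v c") auto
  finally show "\<alpha> \<in> val_left x \<longleftrightarrow> \<alpha> \<in> {\<alpha>. \<alpha> \<le> \<xi>}"
    using mem_val_left_iff[OF a(1,3)] by simp
qed

section \<open>The candidate for W and the fraction rule\<close>

text \<open>Zero is treated apart: L 0 is the whole group, and the cut it gives is still below the
  adjoined infinity.\<close>

definition cut_val :: "'a \<Rightarrow> 'g cut top" where
  "cut_val x = (if x = \<zero> then Top else Value (cut_of_left (val_left x)))"

lemma cut_left_val_left [simp]: "cut_left (cut_of_left (val_left x)) = val_left x"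
  by (rule cut_left_of_left) (rule val_left_downward)

text \<open>\<open>R\<close> contains \<one>, and aR is stable under multiplication by
  \<open>R\<close>, so containing the coset of \<open>r\<close> amounts to containing
  \<open>r\<close>.\<close>

lemma filter_support_eq:
  assumes "r \<in> R"
  shows "filter_support E F v R r = {a \<in> val_ring F v. r \<in> a <# R}"
proof -
  have "r <# R \<subseteq> a <# R \<longleftrightarrow> r \<in> a <# R" if "a \<in> val_ring F v" for a
  proof
    assume "r <# R \<subseteq> a <# R"
    moreover have "r \<in> r <# R"
      unfolding mem_coset using assms by (auto intro!: bexI[of _ \<one>])
    ultimately show "r \<in> a <# R" ..
  next
    assume "r \<in> a <# R"
    then obtain \<rho> where "\<rho> \<in> R" "r = a \<otimes> \<rho>"
      by (auto simp: mem_coset)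
    then have "r \<otimes> \<sigma> \<in> a <# R" if "\<sigma> \<in> R" for \<sigma>
      unfolding mem_coset using that O_F[OF \<open>a \<in> val_ring F v\<close>]
      by (auto simp: m_assoc intro!: bexI[of _ "\<rho> \<otimes> \<sigma>"])
    then show "r <# R \<subseteq> a <# R"
      by (auto simp: mem_coset[of _ r])
  qed
  then show ?thesis
    by (auto simp: filter_support_def)
qed

lemma filter_qv_eq:
  assumes r: "r \<in> R"
  shows "filter_qv E F v R r = cut_val r"
proof -
  have val: "Value \<alpha> \<in> v ` filter_support E F v R r \<longleftrightarrow> 0 \<le> \<alpha> \<and> \<alpha> \<in> val_left r" for \<alpha>
    proof -
    have "Value \<alpha> \<in> v ` filter_support E F v R r \<longleftrightarrow>
        (\<exists>a\<in>F. v a = Value \<alpha> \<and> Value 0 \<le> v a \<and> r \<in> a <# R)"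
      unfolding filter_support_eq[OF r] by (auto simp: O_iff image_iff)
    also have "\<dots> \<longleftrightarrow> (\<exists>a\<in>F. v a = Value \<alpha> \<and> 0 \<le> \<alpha> \<and> r \<in> a <# R)"
      by (intro bex_cong refl) auto
    finally show ?thesis
      by (auto simp: val_left_def)
  qed
  have "cut_hull {\<alpha>. Value \<alpha> \<in> v ` filter_support E F v R r} = cut_of_left (val_left r)"
  proof (rule cut_eqI, unfold cut_left_cut_hull cut_left_val_left val, safe)
    show "\<alpha> \<in> val_left r" if "\<alpha> \<le> \<beta>" "\<beta> \<in> val_left r" for \<alpha> \<beta>
      using that val_left_downward by blast
    \<comment> \<open>The nonnegative part of L r is cofinal in it: r \<in> R puts 0 into L r, so
      the larger of 0 and \<alpha> is a bound inside that part.\<close>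
    show "\<exists>\<beta>\<in>{\<alpha>. 0 \<le> \<alpha> \<and> \<alpha> \<in> val_left r}. \<alpha> \<le> \<beta>" if "\<alpha> \<in> val_left r" for \<alpha>
      using that r zero_mem_val_left[of r] by (intro bexI[of _ "max 0 \<alpha>"]) (auto simp: max_def)
  qed
  then show ?thesis
    by (simp add: filter_qv_def cut_val_def)
qed

lemma cut_val_divide:
  assumes x: "x \<in> carrier E" and s: "s \<in> F" "v s = Value \<sigma>"
  shows "cut_val (x \<otimes> inv s) = cut_val x \<ominus>\<^sub>v \<sigma>"
proof -
  have "s \<noteq> \<zero>"
    using s v_finite by blast
  then have 0: "x \<otimes> inv s = \<zero> \<longleftrightarrow> x = \<zero>"
    using x s by (simp add: eq_divide_iff)
  have "cut_of_left (val_left (x \<otimes> inv s)) = cut_of_left (val_left x) + cut_hull {- \<sigma>}"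
    by (rule cut_eqI) (simp only: cut_left_val_left cut_left_minus, rule val_left_divide[OF assms])
  then show ?thesis
    using 0 by (simp add: cut_val_def minus_val_def embed_val_def)
qed

text \<open>This is well-definedness. \<open>cut_val\<close> involves no choice of a fraction, so
  satisfying the rule for every representation is consistent; as every element is such a fraction,
  the rule leaves no freedom on \<open>E\<close>.\<close>

lemma fraction_rule_iff: "fraction_rule E F v R W \<longleftrightarrow> (\<forall>x\<in>carrier E. W x = cut_val x)"
proof
  assume W: "fraction_rule E F v R W"
  show "\<forall>x\<in>carrier E. W x = cut_val x"
  proof
    fix x assume "x \<in> carrier E"
    then obtain r s where rs: "r \<in> R" "s \<in> val_ring F v - {\<zero>}" "x = r \<otimes> inv s"
      using fraction_representation by blast
    then obtain \<sigma> where "v s = Value \<sigma>"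
      using v_nonzero[of s] by (auto dest: O_F)
    then show "W x = cut_val x"
      using W rs cut_val_divide[of r s \<sigma>] filter_qv_eq
      by (auto simp: fraction_rule_def dest: O_F)
  qed
next
  assume "\<forall>x\<in>carrier E. W x = cut_val x"
  then show "fraction_rule E F v R W"
    by (auto simp: fraction_rule_def cut_val_divide filter_qv_eq inv_nonzero dest: O_F)
qed

section \<open>The quasi-valuation axioms, the restriction to F and the ring O_W\<close>

lemma quasi_valuation_cut_val: "quasi_valuation E cut_val"
  unfolding quasi_valuation_def
proof (intro conjI ballI)
  show "cut_val \<zero> = Top"
    by (simp add: cut_val_def)
  fix x y assume x: "x \<in> carrier E" and y: "y \<in> carrier E"
  have "cut_of_left (val_left x) + cut_of_left (val_left y) \<le> cut_of_left (val_left (x \<otimes> y))"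
    by (auto simp: less_eq_cut_def cut_left_plus val_left_mult)
  then show "cut_val x + cut_val y \<le> cut_val (x \<otimes> y)"
    using x y by (auto simp: cut_val_def)
  have "min (cut_of_left (val_left x)) (cut_of_left (val_left y)) \<le> cut_of_left (val_left (x \<oplus> y))"
    \<comment> \<open>Cuts are linearly ordered, so the left part of the minimum is the intersection
      of both left parts.\<close>
    using linear[of "cut_of_left (val_left x)" "cut_of_left (val_left y)"]
    by (auto simp: min_def less_eq_cut_def intro: val_left_add)
  \<comment> \<open>If one summand is zero, the minimum is the value of the other, which is the
    sum.\<close>
  then show "min (cut_val x) (cut_val y) \<le> cut_val (x \<oplus> y)"
    using x y by (auto simp: cut_val_def min_def split: if_splits)
qed

lemma cut_val_F:
  assumes "x \<in> F"
  shows "cut_val x = embed_val (v x)"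
proof (cases "x = \<zero>")
  case True
  then show ?thesis
    by (simp add: cut_val_def embed_val_def)
next
  case False
  then obtain \<xi> where \<xi>: "v x = Value \<xi>"
    using v_nonzero assms by blast
  have "cut_of_left (val_left x) = cut_hull {\<xi>}"
    by (rule cut_eqI) (simp only: cut_left_val_left, simp add: cut_left_cut_hull val_left_F[OF assms \<xi>])
  then show ?thesis
    using False \<xi> by (simp add: cut_val_def embed_val_def)
qed

lemma val_ring_cut_val: "val_ring (carrier E) cut_val = R"
proof -
  have "0 \<le> cut_val x \<longleftrightarrow> x \<in> R" if x: "x \<in> carrier E" for x
  proof (cases "x = \<zero>")
    case False
    \<comment> \<open>The zero cut has left part {\<alpha>. \<alpha> \<le> 0}, and a down-set
      contains it as soon as it contains 0.\<close>
    have "0 \<le> cut_of_left (val_left x) \<longleftrightarrow> 0 \<in> val_left x"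
      by (auto simp: less_eq_cut_def zero_cut_def cut_left_cut_hull intro: val_left_downward)
    then show ?thesis
      using False x zero_mem_val_left by (simp add: cut_val_def zero_top_def)
  qed (simp add: cut_val_def)
  then show ?thesis
    by (auto simp: val_ring_def)
qed

end

text \<open>Well-definedness is expressed as unique existence; \<open>extensional\<close> fixes the
  values outside the carrier, which the rule does not constrain.\<close>

theorem theorem9p35:
  fixes E :: "('a, 'b) ring_scheme"
    and F R :: "'a set"
    and v :: "'a \<Rightarrow> 'g::linordered_ab_group_add top"
  assumes "field E"
    and "subfield F E"
    and "ring.finite_dimension E F (carrier E)"
    and "valuation (E\<lparr>carrier := F\<rparr>) v"
    and value_group: "v ` F = UNIV"
    and "subring R E"
    and "R \<inter> F = val_ring F v"
    and "fraction_field_of E R"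
  shows
    "(\<forall>x\<in>carrier E. \<exists>r\<in>R. \<exists>s\<in>val_ring F v - {\<zero>\<^bsub>E\<^esub>}. x = r \<otimes>\<^bsub>E\<^esub> inv\<^bsub>E\<^esub> s) \<and>
     (\<exists>!W. W \<in> extensional (carrier E) \<and> fraction_rule E F v R W) \<and>
     (\<forall>W. fraction_rule E F v R W \<longrightarrow>
        quasi_valuation E W \<and>
        (\<forall>x\<in>F. W x = embed_val (v x)) \<and>
        val_ring (carrier E) W = R)"
proof -
  interpret valued_extension E F R v
    using assms by (simp add: valued_extension_def valued_extension_axioms_def)
  have "\<exists>!W. W \<in> extensional (carrier E) \<and> fraction_rule E F v R W"
  proof (rule ex1I[of _ "restrict cut_val (carrier E)"])
    fix W assume W: "W \<in> extensional (carrier E) \<and> fraction_rule E F v R W"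
    then show "W = restrict cut_val (carrier E)"
      by (intro extensionalityI[of _ "carrier E"]) (auto simp: fraction_rule_iff)
  qed (simp add: fraction_rule_iff)
  moreover have "quasi_valuation E W \<and> (\<forall>x\<in>F. W x = embed_val (v x)) \<and>
      val_ring (carrier E) W = R" if "fraction_rule E F v R W" for W
  proof -
    \<comment> \<open>All three claims look at \<open>W\<close> only on the carrier, where it agrees
      with \<open>cut_val\<close>.\<close>
    have W: "W x = cut_val x" if "x \<in> carrier E" for x
      using that \<open>fraction_rule E F v R W\<close> by (simp add: fraction_rule_iff)
    have "quasi_valuation E W"
      using quasi_valuation_cut_val by (simp add: quasi_valuation_def W)
    moreover have "val_ring (carrier E) W = R"
      using val_ring_cut_val by (simp add: val_ring_def W cong: conj_cong)
    ultimately show ?thesis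
      by (simp add: W cut_val_F)
  qed
  ultimately show ?thesis
    using fraction_representation by blast
qed

end
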